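(* For every integer $r\geq 2$, the graph $K^*_{2r+1,2r+1}$ is doubly Eulerian.
   Context: $K^*_{2r+1,2r+1}$ denotes the complete bipartite graph $K_{2r+1,2r+1}$ with the edges of a perfect matching removed. An Eulerian circuit is a closed trail traversing every edge exactly once. Let $G$ be Eulerian with $m$ edges and $u$ a vertex. Two Eulerian circuits $u,v_1,\ldots,v_{m-1},u$ and $u,w_1,\ldots,w_{m-1},u$ are avoiding if for every $1\le i\le m-1$, $v_i\neq w_i$ and $v_i$ is not adjacent to $w_i$. $G$ is doubly Eulerian if it is Eulerian and for every vertex $u$ there is a pair of avoiding Eulerian circuits starting and ending at $u$. *)

theory Defs
  imports Main
begin

text \<open>
  A finite simple graph is given by its vertex set \<open>V\<close> and its set \<open>E\<close> of edges, each edge being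
  a two-element subset of \<open>V\<close>. A walk is given by its nonempty list of vertices.
\<close>

fun walk_edges :: "'a list \<Rightarrow> 'a set list" where
  "walk_edges [] = []"
| "walk_edges [x] = []"
| "walk_edges (x # y # p) = {x, y} # walk_edges (y # p)"

definition is_walk :: "'a set \<Rightarrow> 'a set set \<Rightarrow> 'a list \<Rightarrow> bool" where
  "is_walk V E p \<longleftrightarrow> p \<noteq> [] \<and> set p \<subseteq> V \<and> set (walk_edges p) \<subseteq> E"

definition closed_trail :: "'a set \<Rightarrow> 'a set set \<Rightarrow> 'a list \<Rightarrow> bool" where
  "closed_trail V E p \<longleftrightarrow> is_walk V E p \<and> distinct (walk_edges p) \<and> hd p = last p"

definition eulerian_circuit :: "'a set \<Rightarrow> 'a set set \<Rightarrow> 'a list \<Rightarrow> bool" where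
  "eulerian_circuit V E p \<longleftrightarrow> closed_trail V E p \<and> set (walk_edges p) = E"

definition eulerian :: "'a set \<Rightarrow> 'a set set \<Rightarrow> bool" where
  "eulerian V E \<longleftrightarrow> (\<exists>p. eulerian_circuit V E p)"

text \<open>
  An Eulerian circuit is a list of length \<open>card E + 1\<close> whose entries at positions \<open>0\<close> and \<open>card E\<close>
  are both the starting vertex, so the positions compared below are exactly the inner ones.
\<close>

definition avoiding_circuits ::
    "'a set \<Rightarrow> 'a set set \<Rightarrow> 'a \<Rightarrow> 'a list \<Rightarrow> 'a list \<Rightarrow> bool" where
  "avoiding_circuits V E u p q \<longleftrightarrow>
     eulerian_circuit V E p \<and> hd p = u \<and>
     eulerian_circuit V E q \<and> hd q = u \<and>
     (\<forall>i. 1 \<le> i \<and> i \<le> card E - 1 \<longrightarrow> p ! i \<noteq> q ! i \<and> {p ! i, q ! i} \<notin> E)"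

definition doubly_eulerian :: "'a set \<Rightarrow> 'a set set \<Rightarrow> bool" where
  "doubly_eulerian V E \<longleftrightarrow>
     eulerian V E \<and> (\<forall>u\<in>V. \<exists>p q. avoiding_circuits V E u p q)"

definition complete_bipartite_edges :: "'a set \<Rightarrow> 'a set \<Rightarrow> 'a set set" where
  "complete_bipartite_edges A B = {{a, b} | a b. a \<in> A \<and> b \<in> B}"

definition perfect_matching :: "'a set \<Rightarrow> 'a set set \<Rightarrow> 'a set set \<Rightarrow> bool" where
  "perfect_matching V E M \<longleftrightarrow> M \<subseteq> E \<and> (\<forall>v\<in>V. \<exists>!e. e \<in> M \<and> v \<in> e)"

end

theory Submission
  imports Defs
begin

text \<open>
  Label the two sides \<open>a x\<close> and \<open>b x\<close> by \<open>x\<close> modulo the odd number \<open>n = 2 r + 1\<close>, the removed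
  matching being \<open>a x\<close>, \<open>b x\<close>. Two circuits from \<open>a 0\<close> are at each step on the same side, so they
  only have to be at different vertices. The edge from \<open>a x\<close> to \<open>b (x + d)\<close> has
  difference \<open>d\<close>. Going out along difference \<open>d\<close> and back along \<open>d'\<close> moves by \<open>d - d'\<close>; if
  this is a unit, repeating it \<open>n\<close> times gives a closed trail through all edges of differences \<open>d\<close> and \<open>d'\<close>, and pairing up the \<open>2 r\<close> differences gives an Eulerian
  circuit. The first circuit pairs the differences into \<open>r - 1\<close> closed trails of step \<open>1\<close> followed by
  one, with differences \<open>1\<close> and \<open>- 1\<close>, of step \<open>2\<close>. The second one makes a first move of step
  \<open>4\<close>, with differences \<open>1\<close> and \<open>- 3\<close>, then runs through \<open>r - 1\<close> closed trails of step \<open>1\<close>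
  based at \<open>4\<close>, and finally completes the closed trail of step \<open>4\<close>. The second circuit thus stays
  \<open>3\<close> ahead, until in the last phase the lead is \<open>4 i - 2 i = 2 i\<close> with \<open>0 < i < n\<close>, which is
  nonzero because \<open>n\<close> is odd. On the other side the lead changes by the difference of the two
  outgoing differences: this is \<open>0\<close> in the last phase, and before it the outgoing differences are
  chosen so that they never cancel the lead \<open>3\<close>.
\<close>

section \<open>Walks alternating between two sequences of vertices\<close>

lemma length_walk_edges: "length (walk_edges p) = length p - 1"
  by (induction p rule: walk_edges.induct) auto

lemma nth_walk_edges: "Suc i < length p \<Longrightarrow> walk_edges p ! i = {p ! i, p ! Suc i}"
  by (induction p arbitrary: i rule: walk_edges.induct) (auto simp: nth_Cons split: nat.split)

definition zigzag :: "nat \<Rightarrow> (nat \<Rightarrow> 'a) \<Rightarrow> (nat \<Rightarrow> 'a) \<Rightarrow> 'a list" where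
  "zigzag N f g = map (\<lambda>k. if even k then f (k div 2) else g (k div 2)) [0..<Suc (2 * N)]"

lemma length_zigzag: "length (zigzag N f g) = Suc (2 * N)"
  by (simp add: zigzag_def)

lemma nth_zigzag:
  "k \<le> 2 * N \<Longrightarrow> zigzag N f g ! k = (if even k then f (k div 2) else g (k div 2))"
  unfolding zigzag_def by (simp del: upt_Suc)

lemma hd_zigzag: "hd (zigzag N f g) = f 0"
  using nth_zigzag[of 0 N f g] length_zigzag[of N f g] by (cases "zigzag N f g") auto

lemma last_zigzag: "last (zigzag N f g) = f N"
  unfolding zigzag_def by simp

lemma set_walk_edges_zigzag:
  "set (walk_edges (zigzag N f g)) = (\<Union>t<N. {{f t, g t}, {g t, f (Suc t)}})"
proof -
  have *: "walk_edges (zigzag N f g) ! k =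
      (if even k then {f (k div 2), g (k div 2)} else {g (k div 2), f (Suc (k div 2))})"
    if "k < 2 * N" for k
    using that by (auto simp: nth_walk_edges length_zigzag nth_zigzag)
  have len: "length (walk_edges (zigzag N f g)) = 2 * N"
    by (simp add: length_walk_edges length_zigzag)
  show ?thesis
  proof (intro equalityI subsetI)
    fix e assume "e \<in> set (walk_edges (zigzag N f g))"
    then obtain k where "k < 2 * N" "e = walk_edges (zigzag N f g) ! k"
      by (auto simp: in_set_conv_nth len)
    then show "e \<in> (\<Union>t<N. {{f t, g t}, {g t, f (Suc t)}})"
      using * by (auto intro!: bexI[of _ "k div 2"])
  next
    fix e assume "e \<in> (\<Union>t<N. {{f t, g t}, {g t, f (Suc t)}})"
    then obtain t where t: "t < N" and "e = {f t, g t} \<or> e = {g t, f (Suc t)}"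
      by auto
    then have "e = walk_edges (zigzag N f g) ! (2 * t) \<or>
        e = walk_edges (zigzag N f g) ! Suc (2 * t)"
      using *[of "2 * t"] *[of "Suc (2 * t)"] by auto
    then show "e \<in> set (walk_edges (zigzag N f g))"
      using t len nth_mem[of "2 * t" "walk_edges (zigzag N f g)"]
        nth_mem[of "Suc (2 * t)" "walk_edges (zigzag N f g)"] by auto
  qed
qed

text \<open>A walk that covers every edge and makes only as many moves as there are edges cannot
  repeat one, so covering and counting replace a direct proof of distinctness.\<close>

lemma eulerian_circuit_zigzag:
  assumes "(\<Union>t<N. {{f t, g t}, {g t, f (Suc t)}}) = E" "card E = 2 * N"
    and "f N = f 0" "range f \<subseteq> V" "range g \<subseteq> V"
  shows "eulerian_circuit V E (zigzag N f g)"
proof -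
  have edges: "set (walk_edges (zigzag N f g)) = E"
    using assms(1) by (simp add: set_walk_edges_zigzag)
  have "distinct (walk_edges (zigzag N f g))"
    by (rule card_distinct) (simp add: edges assms(2) length_walk_edges length_zigzag)
  moreover have "set (zigzag N f g) \<subseteq> V"
    using assms(4,5) by (auto simp: zigzag_def)
  moreover have "zigzag N f g \<noteq> []"
    using length_zigzag[of N f g] by auto
  ultimately show ?thesis
    using edges assms(3)
    by (simp add: eulerian_circuit_def closed_trail_def is_walk_def hd_zigzag last_zigzag)
qed

section \<open>The graph labelled by residues modulo \<open>n\<close>\<close>

text \<open>The labels are \<open>n\<close>-periodic functions on all integers, so positions need no
  reduction and equality of vertices becomes divisibility by \<open>n\<close>.\<close>

locale cyclic_labelling =
  fixes r n :: nat and a b :: "int \<Rightarrow> 'a"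
  assumes r_ge: "r \<ge> 2" and n_def: "n = 2 * r + 1"
    and a_eq: "a x = a y \<longleftrightarrow> int n dvd x - y"
    and b_eq: "b x = b y \<longleftrightarrow> int n dvd x - y"
    and a_neq_b: "a x \<noteq> b y"
begin

definition V :: "'a set" where "V = range a \<union> range b"

definition E :: "'a set set" where
  "E = {{a x, b (x + d)} | x d. d \<in> {1..2 * int r}}"

lemma edge_eq: "{a x, b y} = {a x', b y'} \<longleftrightarrow> a x = a x' \<and> b y = b y'"
  using a_neq_b by (auto simp: doubleton_eq_iff)

lemma n_int: "int n = 2 * int r + 1"
  by (simp add: n_def)

lemma n_gt: "2 * r < n" "0 < n"
  by (simp_all add: n_def)

lemma small_not_dvd: "z \<noteq> 0 \<Longrightarrow> \<bar>z\<bar> < int n \<Longrightarrow> \<not> int n dvd z"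
  using dvd_imp_le_int[of z "int n"] by auto

lemma coprime_n_2: "coprime (int n) 2"
  by (simp add: n_def)

lemma card_E: "card E = 2 * (r * n)"
proof -
  let ?f = "\<lambda>(x, d). {a x, b (x + d)}"
  \<comment> \<open>One representative per residue, so that each edge comes from exactly one
    pair.\<close>
  let ?S = "{0..<int n} \<times> {1..2 * int r}"
  have "inj_on ?f ?S"
  proof (rule inj_onI, clarify)
    fix x d x' d'
    assume x: "x \<in> {0..<int n}" "x' \<in> {0..<int n}" and d: "d \<in> {1..2 * int r}" "d' \<in> {1..2 * int r}"
      and "{a x, b (x + d)} = {a x', b (x' + d')}"
    then have 1: "int n dvd x - x'" and 2: "int n dvd (x + d) - (x' + d')"
      by (auto simp: edge_eq a_eq b_eq)
    have xx: "x = x'"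
      using 1 x by (metis atLeastLessThan_iff mod_eq_dvd_iff mod_pos_pos_trivial)
    moreover have "int n dvd d - d'" using 2 xx by simp
    then have "d = d'"
      using d n_def by (metis (no_types, opaque_lifting) atLeastAtMost_iff diff_add_cancel
        mod_eq_dvd_iff mod_pos_pos_trivial of_nat_add of_nat_1 of_nat_mult of_nat_numeral
        order_trans zero_le_one zle_add1_eq_le)
    ultimately show "x = x' \<and> d = d'" by simp
  qed
  moreover have "E = ?f ` ?S"
  proof (intro equalityI subsetI)
    fix e assume "e \<in> E"
    then obtain x d where d: "d \<in> {1..2 * int r}" and e: "e = {a x, b (x + d)}"
      unfolding E_def by auto
    have "int n dvd x - x mod int n" by (simp add: dvd_minus_mod)
    then have "e = ?f (x mod int n, d)"
      using e by (simp add: edge_eq a_eq b_eq)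
    moreover have "(x mod int n, d) \<in> ?S"
      using d by (simp add: n_def)
    ultimately show "e \<in> ?f ` ?S" by blast
  next
    fix e assume "e \<in> ?f ` ?S"
    then obtain x d where "d \<in> {1..2 * int r}" "e = {a x, b (x + d)}" by auto
    then show "e \<in> E" unfolding E_def by blast
  qed
  ultimately show ?thesis
    by (simp add: card_image card_cartesian_product nat_mult_distrib)
qed

text \<open>
  The walk follows blocks: in block \<open>j\<close> it leaves the side of \<open>a\<close> along difference \<open>D j\<close> and comes
  back along difference \<open>D' j\<close>.
\<close>

lemma eulerian_circuit_blocks:
  fixes P :: "nat \<Rightarrow> int" and k :: "nat \<Rightarrow> nat" and D D' :: "nat \<Rightarrow> int"
  assumes k: "\<And>t. t < r * n \<Longrightarrow> k t < r"
    and step: "\<And>t. t < r * n \<Longrightarrow> int n dvd P (Suc t) - (P t + D (k t) - D' (k t))"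
    and D: "\<And>j. j < r \<Longrightarrow> D j \<in> {1..2 * int r}" "\<And>j. j < r \<Longrightarrow> D' j \<in> {1..2 * int r}"
    and closed: "int n dvd P (r * n) - P 0"
    and hit: "\<And>j x. j < r \<Longrightarrow> \<exists>t<r * n. k t = j \<and> int n dvd P t - x"
    and cover: "\<And>d. d \<in> {1..2 * int r} \<Longrightarrow> \<exists>j<r. D j = d \<or> D' j = d"
  shows "eulerian_circuit V E (zigzag (r * n) (\<lambda>t. a (P t)) (\<lambda>t. b (P t + D (k t))))"
proof (rule eulerian_circuit_zigzag)
  have home_edge: "{b (P t + D (k t)), a (P (Suc t))} =
      {a (P t + D (k t) - D' (k t)), b (P t + D (k t) - D' (k t) + D' (k t))}"
    if "t < r * n" for t
  proof -
    have "a (P (Suc t)) = a (P t + D (k t) - D' (k t))"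
      using step[OF that] a_eq by blast
    then show ?thesis by (simp add: insert_commute)
  qed
  show "(\<Union>t<r * n. {{a (P t), b (P t + D (k t))}, {b (P t + D (k t)), a (P (Suc t))}}) = E"
    (is "?U = E")
  proof (intro equalityI subsetI)
    fix e assume "e \<in> ?U"
    then obtain t where t: "t < r * n"
      and "e = {a (P t), b (P t + D (k t))} \<or> e = {b (P t + D (k t)), a (P (Suc t))}"
      by auto
    then have "\<exists>x. e = {a x, b (x + D (k t))} \<or> e = {a x, b (x + D' (k t))}"
      using home_edge[OF t] by metis
    then show "e \<in> E"
      using D[OF k[OF t]] unfolding E_def by blast
  next
    fix e assume "e \<in> E"
    then obtain x d where d: "d \<in> {1..2 * int r}" and e: "e = {a x, b (x + d)}"
      unfolding E_def by auto
    from cover[OF d] obtain j where j: "j < r" and "D j = d \<or> D' j = d" by blast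
    then consider "D j = d" | "D' j = d" by blast
    then show "e \<in> ?U"
    proof cases
      case 1
      obtain t where t: "t < r * n" "k t = j" "int n dvd P t - x" using hit[OF j] by blast
      then have "e = {a (P t), b (P t + D (k t))}"
        using e 1 by (simp add: edge_eq a_eq b_eq) (simp add: dvd_diff_commute)
      then show ?thesis using t by blast
    next
      case 2
      \<comment> \<open>The return edge at \<open>a x\<close> along \<open>D' j\<close> is used by
        the step of block \<open>j\<close> that starts at \<open>x + D' j - D j\<close>: its
        outgoing move reaches \<open>b (x + D' j)\<close>.\<close>
      obtain t where t: "t < r * n" "k t = j" "int n dvd P t - (x + D' j - D j)"
        using hit[OF j] by blast
      have "int n dvd x - (P t + D (k t) - D' (k t))"
        using t dvd_minus_iff[of "int n" "P t - (x + D' j - D j)"] by (simp add: algebra_simps)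
      then have "e = {a (P t + D (k t) - D' (k t)), b (P t + D (k t) - D' (k t) + D' (k t))}"
        unfolding e edge_eq a_eq b_eq using 2 t(2) by (simp add: algebra_simps)
      then show ?thesis using home_edge[OF t(1)] t(1) by blast
    qed
  qed
  show "a (P (r * n)) = a (P 0)" using closed a_eq by blast
qed (auto simp: card_E V_def)

lemma divmod_Suc:
  obtains (stay) "Suc (t mod n) < n" "Suc t mod n = Suc (t mod n)" "Suc t div n = t div n"
  | (wrap) "t mod n = 2 * r" "Suc t mod n = 0" "Suc t div n = Suc (t div n)"
proof (cases "Suc (t mod n) = n")
  case True
  then show ?thesis using wrap n_def by (simp add: mod_Suc div_Suc)
next
  case False
  moreover have "t mod n < n" by (simp add: n_def)
  ultimately have "Suc (t mod n) < n" by simp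
  then show ?thesis by (intro stay) (simp_all add: mod_Suc div_Suc)
qed

lemma block_less: "t < r * n \<Longrightarrow> t div n < r"
  by (simp add: less_mult_imp_div_less)

lemma hit_block:
  assumes "j < r" "coprime (int n) c"
  shows "\<exists>t<r * n. t div n = j \<and> int n dvd c * int (t mod n) - x"
proof -
  obtain u v where uv: "u * int n + v * c = 1"
    using bezout_int[of "int n" c] assms(2) by (auto simp: coprime_iff_gcd_eq_1)
  \<comment> \<open>By Bezout \<open>v\<close> inverts \<open>c\<close> modulo \<open>n\<close>, so
    \<open>c * int i\<close> is congruent to \<open>x\<close>.\<close>
  define i where "i = nat ((v * x) mod int n)"
  have i: "i < n" "int i = (v * x) mod int n"
    using n_def by (auto simp: i_def nat_less_iff)
  have "int n dvd c * (v * x - int i)"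
    by (simp add: i(2) dvd_minus_mod)
  moreover have "c * int i - x = - (c * (v * x - int i)) - int n * (u * x)"
    using uv by algebra
  ultimately have "int n dvd c * int i - x"
    by (metis dvd_diff dvd_minus_iff dvd_triv_left)
  moreover have "j * n + i < r * n"
  proof -
    have "Suc j * n \<le> r * n" using assms(1) by (intro mult_le_mono1) simp
    then show ?thesis using i(1) by simp
  qed
  ultimately show ?thesis
    using i(1) by (intro exI[of _ "j * n + i"]) simp
qed

section \<open>The two Eulerian circuits\<close>

definition P1 :: "nat \<Rightarrow> int" where
  "P1 t = (if t div n = r - 1 then 2 else 1) * int (t mod n)"

definition D1 :: "nat \<Rightarrow> int" where
  "D1 j = (if j = r - 1 then 1 else 2 * int j + 3)"

text \<open>Modulo \<open>n\<close>, \<open>2 * int r\<close> is -1, so the last block has step 2;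
  the earlier blocks have step 1.\<close>

definition D1' :: "nat \<Rightarrow> int" where
  "D1' j = (if j = r - 1 then 2 * int r else 2 * int j + 2)"

text \<open>Time is shifted by one because the first move of the trail of step 4 is made at the
  outset. The last block therefore resumes at 4, which explains the factor
  \<open>s mod n + 1\<close>.\<close>

definition P2 :: "nat \<Rightarrow> int" where
  "P2 t = (case t of 0 \<Rightarrow> 0 | Suc s \<Rightarrow>
     if s div n = r - 1 then 4 * (int (s mod n) + 1) else int (s mod n) + 4)"

definition k2 :: "nat \<Rightarrow> nat" where
  "k2 t = (case t of 0 \<Rightarrow> r - 1 | Suc s \<Rightarrow> s div n)"

definition D2 :: "nat \<Rightarrow> int" where
  "D2 j = (if j = r - 1 then 1 else if j = r - 2 then 2 * int r else 2 * int j + 3)"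

text \<open>Modulo \<open>n\<close>, \<open>2 * int r - 2\<close> is -3, which gives step 4 in the
  last block. Taking it from its pair in the first circuit leaves \<open>2 r - 1\<close> and
  \<open>2 r\<close> for block \<open>r - 2\<close>, again with step 1.\<close>

definition D2' :: "nat \<Rightarrow> int" where
  "D2' j = (if j = r - 1 then 2 * int r - 2 else if j = r - 2 then 2 * int r - 1
     else 2 * int j + 2)"

lemma circuit1:
  "eulerian_circuit V E (zigzag (r * n) (\<lambda>t. a (P1 t)) (\<lambda>t. b (P1 t + D1 (t div n))))"
proof (rule eulerian_circuit_blocks[where D' = D1'])
  show "int n dvd P1 (Suc t) - (P1 t + D1 (t div n) - D1' (t div n))" (is "int n dvd ?z")
    if "t < r * n" for t
  proof -
    \<comment> \<open>Multiples of \<open>n\<close> arise when a block restarts at 0 and when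
      \<open>2 * int r\<close> stands for -1.\<close>
    have "?z \<in> {0, int n, - int n}"
      using block_less[OF that] r_ge
      by (cases rule: divmod_Suc[of t]) (auto simp: P1_def D1_def D1'_def n_int)
    then show ?thesis by auto
  qed
  show "\<exists>t<r * n. t div n = j \<and> int n dvd P1 t - x" if "j < r" for j x
    using hit_block[OF that, of "if j = r - 1 then 2 else 1" x] coprime_n_2
    by (cases "j = r - 1") (fastforce simp: P1_def)+
  show "\<exists>j<r. D1 j = d \<or> D1' j = d" if "d \<in> {1..2 * int r}" for d
  proof (cases "d = 1 \<or> d = 2 * int r")
    case True
    then show ?thesis
      using r_ge by (intro exI[of _ "r - 1"]) (auto simp: D1_def D1'_def)
  next
    case False
    then show ?thesis
      using that r_ge by (intro exI[of _ "nat (d - 2) div 2"]) (auto simp: D1_def D1'_def; presburger)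
  qed
  show "int n dvd P1 (r * n) - P1 0"
    using n_gt by (simp add: P1_def)
  show "t div n < r" if "t < r * n" for t
    using block_less[OF that] .
  show "D1 j \<in> {1..2 * int r}" "D1' j \<in> {1..2 * int r}" if "j < r" for j
    using that r_ge by (auto simp: D1_def D1'_def)
qed

lemma circuit2:
  "eulerian_circuit V E (zigzag (r * n) (\<lambda>t. a (P2 t)) (\<lambda>t. b (P2 t + D2 (k2 t))))"
proof (rule eulerian_circuit_blocks[where D' = D2'])
  show "k2 t < r" if "t < r * n" for t
    using that block_less[of "t - 1"] r_ge by (auto simp: k2_def split: nat.splits)
  show "int n dvd P2 (Suc t) - (P2 t + D2 (k2 t) - D2' (k2 t))" (is "int n dvd ?z")
    if "t < r * n" for t
  proof (cases t)
    case 0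
    then have "?z = int n" using r_ge by (auto simp: P2_def k2_def D2_def D2'_def n_int)
    then show ?thesis by simp
  next
    case (Suc s)
    then have "?z \<in> {0, int n, - int n}"
      using block_less[OF that] r_ge
      by (cases rule: divmod_Suc[of s]) (auto simp: P2_def k2_def D2_def D2'_def n_int)
    then show ?thesis by auto
  qed
  show "int n dvd P2 (r * n) - P2 0"
  proof -
    \<comment> \<open>The last move starts at offset \<open>2 r\<close> of the last block, so the
      final position is \<open>4 * int n\<close>.\<close>
    have "r * n = Suc ((r - 1) * n + 2 * r)"
      using r_ge n_def by (cases r) auto
    then have "P2 (r * n) - P2 0 = 4 * int n"
      using n_gt by (simp add: P2_def) (simp add: n_int)
    then show ?thesis by simp
  qed
  show "\<exists>t<r * n. k2 t = j \<and> int n dvd P2 t - x" if j: "j < r" for j x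
  proof (cases "j = r - 1")
    case True
    have "coprime (int n) (2 * 2)"
      using coprime_n_2 by (simp only: coprime_mult_right_iff)
    then obtain t where t: "t < r * n" "t div n = j" "int n dvd 4 * int (t mod n) - x"
      using hit_block[OF j, of 4 x] by auto
    \<comment> \<open>Offset 0 of the trail of step 4 is visited at time 0; its other offsets keep
      their place in the last block despite the shift of time.\<close>
    show ?thesis
    proof (cases "t mod n = 0")
      case True
      then show ?thesis
        using t \<open>j = r - 1\<close> r_ge n_gt by (intro exI[of _ 0]) (simp add: P2_def k2_def)
    next
      case False
      then obtain s where s: "t = Suc s" by (cases t) auto
      show ?thesis
        using t False \<open>j = r - 1\<close> unfolding s
        by (cases rule: divmod_Suc[of s]) (auto simp: P2_def k2_def algebra_simps intro!: exI[of _ "Suc s"])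
    qed
  next
    case False
    obtain s where s: "s < r * n" "s div n = j" "int n dvd 1 * int (s mod n) - (x - 4)"
      using hit_block[OF j, of 1 "x - 4"] by auto
    \<comment> \<open>Since \<open>s\<close> lies before the last block, the shifted time is still
      in range.\<close>
    have "Suc s \<noteq> r * n"
    proof
      assume "Suc s = r * n"
      then have "s = (r - 1) * n + 2 * r"
        using r_ge n_def by (cases r) auto
      then show False using False s(2) n_gt by simp
    qed
    then show ?thesis
      using s False by (intro exI[of _ "Suc s"]) (auto simp: P2_def k2_def algebra_simps)
  qed
  show "\<exists>j<r. D2 j = d \<or> D2' j = d" if "d \<in> {1..2 * int r}" for d
  proof -
    consider "d = 1 \<or> d = 2 * int r - 2" | "d = 2 * int r \<or> d = 2 * int r - 1"
      | "2 \<le> d" "d \<le> 2 * int r - 3"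
      using \<open>d \<in> {1..2 * int r}\<close> by fastforce
    then show ?thesis
    proof cases
      case 1
      then show ?thesis
        using r_ge by (intro exI[of _ "r - 1"]) (auto simp: D2_def D2'_def)
    next
      case 2
      then show ?thesis
        using r_ge by (intro exI[of _ "r - 2"]) (auto simp: D2_def D2'_def)
    next
      case 3
      define j where "j = nat ((d - 2) div 2)"
      have "int j = (d - 2) div 2" using 3 by (simp add: j_def)
      then have "d = 2 * int j + 2 \<or> d = 2 * int j + 3" by presburger
      moreover from this have "j < r - 2" using 3 by linarith
      ultimately show ?thesis
        by (intro exI[of _ j]) (auto simp: D2_def D2'_def)
    qed
  qed
  show "D2 j \<in> {1..2 * int r}" "D2' j \<in> {1..2 * int r}" if "j < r" for j
    using that r_ge by (auto simp: D2_def D2'_def)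
qed

section \<open>The lead of the second circuit over the first\<close>

lemma P1_Suc:
  assumes "s div n \<noteq> r - 1"
  shows "int n dvd P1 (Suc s) - (int (s mod n) + 1)"
proof (cases rule: divmod_Suc[of s])
  case stay
  then show ?thesis using assms by (simp add: P1_def)
next
  \<comment> \<open>At a change of block the first circuit is back at 0, whatever the next step is,
    and 0 agrees with \<open>s mod n + 1 = n\<close> modulo \<open>n\<close>.\<close>
  case wrap
  then have "P1 (Suc s) - (int (s mod n) + 1) = - int n" by (simp add: P1_def n_int)
  then show ?thesis by simp
qed

lemma avoid_a:
  assumes "0 < t" "t < r * n"
  shows "\<not> int n dvd P2 t - P1 t"
proof -
  obtain s where s: "t = Suc s" using assms(1) by (cases t) auto
  have blk: "t div n < r" using block_less assms(2) by simp
  show ?thesis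
  proof (cases "s div n = r - 1")
    case True
    show ?thesis
    proof (cases rule: divmod_Suc[of s])
      case stay
      have "P2 t - P1 t = 2 * (int (s mod n) + 1)"
        using stay True by (simp add: s P2_def P1_def)
      moreover have "\<not> int n dvd int (s mod n) + 1"
        using stay small_not_dvd[of "int (s mod n) + 1"] by linarith
      ultimately show ?thesis
        using coprime_n_2 by (simp only: coprime_dvd_mult_right_iff not_False_eq_True)
    next
      \<comment> \<open>Leaving the last block would put \<open>t\<close> in block \<open>r\<close>,
        beyond the end.\<close>
      case wrap
      then show ?thesis using True blk s by simp
    qed
  next
    case False
    have "int n dvd P1 t - (int (s mod n) + 1)"
      using P1_Suc[OF False] by (simp add: s)
    moreover have "P2 t - P1 t = 3 - (P1 t - (int (s mod n) + 1))"
      using False by (simp add: s P2_def)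
    moreover have "\<not> int n dvd 3"
      using n_def r_ge by (intro small_not_dvd) auto
    ultimately show ?thesis
      by (metis dvd_diff_left_iff)
  qed
qed

lemma avoid_b:
  assumes "t < r * n"
  shows "\<not> int n dvd (P2 t + D2 (k2 t)) - (P1 t + D1 (t div n))" (is "\<not> int n dvd ?z")
proof (cases t)
  case 0
  then have "\<bar>?z\<bar> = 2"
    using r_ge by (auto simp: P1_def P2_def D1_def D2_def k2_def)
  then show ?thesis
    using r_ge n_def by (intro small_not_dvd) auto
next
  case s: (Suc s)
  have blk: "t div n < r" using block_less assms by simp
  show ?thesis
  proof (cases "s div n = r - 1")
    case True
    show ?thesis
    proof (cases rule: divmod_Suc[of s])
      case stay
      have "?z = 2 * (int (s mod n) + 1)"
        using stay True by (simp add: s P2_def P1_def k2_def D1_def D2_def)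
      moreover have "\<not> int n dvd int (s mod n) + 1"
        using stay small_not_dvd[of "int (s mod n) + 1"] by linarith
      ultimately show ?thesis
        using coprime_n_2 by (simp only: coprime_dvd_mult_right_iff not_False_eq_True)
    next
      case wrap
      then show ?thesis using True blk s by simp
    qed
  next
    case False
    \<comment> \<open>The second circuit runs one time unit late, so the first may already have
      entered the next block.\<close>
    have j: "s div n < r - 1" "t div n = s div n \<or> t div n = Suc (s div n)"
      using False block_less[of s] assms s div_Suc[of s n] by auto
    have "int n dvd P1 t - (int (s mod n) + 1)"
      using P1_Suc[OF False] by (simp add: s)
    moreover have "?z = (3 + D2 (s div n) - D1 (t div n)) - (P1 t - (int (s mod n) + 1))"
      using False by (simp add: s P2_def k2_def)
    moreover have "\<not> int n dvd 3 + D2 (s div n) - D1 (t div n)"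
    proof (cases "s div n = r - 2")
      \<comment> \<open>Here \<open>3 + 2 r\<close> is \<open>n + 2\<close>, while
        \<open>D1 (t div n)\<close> is \<open>2 r - 1\<close>, or 1 once the first circuit is in its
        last block; neither is congruent to 2.\<close>
      case True
      then have "3 + D2 (s div n) - D1 (t div n) = int n + (2 - D1 (t div n))"
        using r_ge by (auto simp: D2_def n_int)
      moreover have "\<not> int n dvd 2 - D1 (t div n)"
        using j r_ge True by (intro small_not_dvd) (auto simp: D1_def n_int)
      ultimately show ?thesis by (simp only: dvd_add_triv_left_iff not_False_eq_True)
    next
      case False
      then have "s div n < r - 2" using j by linarith
      \<comment> \<open>The value is 3 within a common block and 1 when the first circuit is one
        block further.\<close>
      then have "3 + D2 (s div n) - D1 (t div n) \<in> {1, 3}"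
        using j(2) by (auto simp: D1_def D2_def)
      then show ?thesis
        using r_ge n_def by (intro small_not_dvd) auto
    qed
    ultimately show ?thesis
      by (metis dvd_diff_left_iff)
  qed
qed

lemma avoiding: "\<exists>p q. avoiding_circuits V E (a 0) p q"
proof (intro exI)
  let ?p = "zigzag (r * n) (\<lambda>t. a (P2 t)) (\<lambda>t. b (P2 t + D2 (k2 t)))"
  let ?q = "zigzag (r * n) (\<lambda>t. a (P1 t)) (\<lambda>t. b (P1 t + D1 (t div n)))"
  have E: "{a x, a y} \<notin> E" "{b x, b y} \<notin> E" for x y
    using a_neq_b by (auto simp: E_def doubleton_eq_iff; metis)+
  have "?p ! i \<noteq> ?q ! i \<and> {?p ! i, ?q ! i} \<notin> E" if "1 \<le> i" "i \<le> card E - 1" for i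
  proof -
    have i: "i < 2 * (r * n)" using that r_ge n_def by (simp add: card_E)
    \<comment> \<open>Even inner positions exclude the common start \<open>a 0\<close>; odd ones
      begin with index 0, which \<open>avoid_b\<close> includes.\<close>
    then have "0 < i div 2" if "even i" using that \<open>1 \<le> i\<close> by auto
    then show ?thesis
      using i avoid_a[of "i div 2"] avoid_b[of "i div 2"]
      by (auto simp: nth_zigzag E a_eq b_eq)
  qed
  then show "avoiding_circuits V E (a 0) ?p ?q"
    using circuit1 circuit2 by (simp add: avoiding_circuits_def hd_zigzag P1_def P2_def)
qed

end

section \<open>From a perfect matching to a cyclic labelling\<close>

lemma perfect_matching_bij:
  assumes disj: "A \<inter> B = {}"
    and M: "perfect_matching (A \<union> B) (complete_bipartite_edges A B) M"
  obtains h where "bij_betw h A B"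
    and "\<And>x y. x \<in> A \<Longrightarrow> y \<in> B \<Longrightarrow> {x, y} \<in> M \<longleftrightarrow> y = h x"
proof -
  have ex1: "\<exists>!e. e \<in> M \<and> v \<in> e" if "v \<in> A \<union> B" for v
    using M that unfolding perfect_matching_def by blast
  have sub: "\<exists>x\<in>A. \<exists>y\<in>B. e = {x, y}" if "e \<in> M" for e
    using M that unfolding perfect_matching_def complete_bipartite_edges_def by blast
  have ex1_B: "\<exists>!y. y \<in> B \<and> {x, y} \<in> M" if x: "x \<in> A" for x
  proof -
    obtain e where e: "e \<in> M" "x \<in> e" using ex1 x by blast
    obtain x' y where xy: "x' \<in> A" "y \<in> B" "e = {x', y}" using sub[OF e(1)] by blast
    have "x' = x" using xy e x disj by auto
    then have "y \<in> B \<and> {x, y} \<in> M" using xy e by simp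
    moreover have "z = y" if "z \<in> B" "{x, z} \<in> M" for z
    proof -
      have "{x, z} = {x, y}" using ex1[of x] x that calculation by blast
      then show ?thesis by (auto simp: doubleton_eq_iff)
    qed
    ultimately show ?thesis by blast
  qed
  have ex1_A: "\<exists>!x. x \<in> A \<and> {x, y} \<in> M" if y: "y \<in> B" for y
  proof -
    obtain e where e: "e \<in> M" "y \<in> e" using ex1 y by blast
    obtain x y' where xy: "x \<in> A" "y' \<in> B" "e = {x, y'}" using sub[OF e(1)] by blast
    have "y' = y" using xy e y disj by auto
    then have "x \<in> A \<and> {x, y} \<in> M" using xy e by simp
    moreover have "z = x" if "z \<in> A" "{z, y} \<in> M" for z
    proof -
      have "{z, y} = {x, y}" using ex1[of y] y that calculation by blast
      then show ?thesis by (auto simp: doubleton_eq_iff)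
    qed
    ultimately show ?thesis by blast
  qed
  define h where "h x = (THE y. y \<in> B \<and> {x, y} \<in> M)" for x
  have h: "h x \<in> B \<and> {x, h x} \<in> M" if "x \<in> A" for x
    unfolding h_def by (rule theI'[OF ex1_B[OF that]])
  have h_iff: "{x, y} \<in> M \<longleftrightarrow> y = h x" if "x \<in> A" "y \<in> B" for x y
    using h[OF that(1)] ex1_B[OF that(1)] that(2) by blast
  moreover have "bij_betw h A B"
    unfolding bij_betw_def inj_on_def
  proof (intro conjI ballI impI equalityI subsetI)
    fix x x' assume x: "x \<in> A" "x' \<in> A" and "h x = h x'"
    then have "{x, h x} \<in> M" "{x', h x} \<in> M" "h x \<in> B" using h by metis+
    then show "x = x'" using ex1_A x by blast
  next
    fix y assume "y \<in> B"
    then show "y \<in> h ` A" using ex1_A h_iff by blast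
  qed (use h in auto)
  ultimately show ?thesis using that by blast
qed

text \<open>Enumerating \<open>A\<close> cyclically from \<open>u\<close> and giving matched
  vertices equal labels makes \<open>M\<close> the edges of difference 0 and puts \<open>u\<close>
  at \<open>a 0\<close>.\<close>

lemma avoiding_circuits_left:
  fixes r :: nat and A B :: "'a set" and M :: "'a set set"
  assumes r: "r \<ge> 2" and disj: "A \<inter> B = {}" and card: "card A = 2 * r + 1"
    and M: "perfect_matching (A \<union> B) (complete_bipartite_edges A B) M"
    and u: "u \<in> A"
  shows "\<exists>p q. avoiding_circuits (A \<union> B) (complete_bipartite_edges A B - M) u p q"
proof -
  define n where "n = 2 * r + 1"
  obtain h where h: "bij_betw h A B"
    and h_iff: "\<And>x y. x \<in> A \<Longrightarrow> y \<in> B \<Longrightarrow> {x, y} \<in> M \<longleftrightarrow> y = h x"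
    using perfect_matching_bij[OF disj M] by metis
  have "finite A" using card by (simp add: card_ge_0_finite)
  then obtain f where f: "bij_betw f {0..<n} A"
    using ex_bij_betw_nat_finite card n_def by metis
  then obtain k where k: "k < n" "f k = u"
    using u by (metis atLeastLessThan_iff bij_betw_iff_bijections)
  define a where "a x = f (nat ((x + int k) mod int n))" for x
  define b where "b x = h (a x)" for x
  have n_pos: "0 < int n" by (simp add: n_def)
  have idx: "nat (z mod int n) \<in> {0..<n}" for z
    using n_pos by (simp add: nat_less_iff)
  have a_in: "a x \<in> A" for x
    using f idx unfolding a_def by (blast dest: bij_betwE)
  have b_in: "b x \<in> B" for x
    using h a_in unfolding b_def by (blast dest: bij_betwE)
  have a_eq: "a x = a y \<longleftrightarrow> int n dvd x - y" for x y
  proof -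
    have "a x = a y \<longleftrightarrow> nat ((x + int k) mod int n) = nat ((y + int k) mod int n)"
      unfolding a_def using f idx by (auto simp only: bij_betw_def inj_on_eq_iff)
    also have "\<dots> \<longleftrightarrow> (x + int k) mod int n = (y + int k) mod int n"
      using n_pos by (simp add: eq_nat_nat_iff)
    also have "\<dots> \<longleftrightarrow> int n dvd x - y"
      by (simp add: mod_eq_dvd_iff)
    finally show ?thesis .
  qed
  have b_eq: "b x = b y \<longleftrightarrow> int n dvd x - y" for x y
    using h a_in a_eq unfolding b_def by (metis bij_betw_def inj_on_eq_iff)
  interpret cyclic_labelling r n a b
  proof
    show "a x \<noteq> b y" for x y using a_in[of x] b_in[of y] disj by auto
  qed (use r n_def a_eq b_eq in auto)
  have range_a: "range a = A"
  proof (intro equalityI subsetI)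
    fix v assume "v \<in> A"
    then obtain i where "i < n" "f i = v"
      using f by (metis atLeastLessThan_iff bij_betw_iff_bijections)
    then have "a (int i - int k) = v" by (simp add: a_def)
    then show "v \<in> range a" by blast
  qed (use a_in in auto)
  have range_b: "range b = B"
    using h range_a unfolding b_def bij_betw_def by (metis image_image)
  have "E = complete_bipartite_edges A B - M"
  proof (intro equalityI subsetI)
    fix e assume "e \<in> E"
    then obtain x d where d: "d \<in> {1..2 * int r}" and e: "e = {a x, b (x + d)}"
      unfolding E_def by auto
    have "\<not> int n dvd d"
      using d n_def by (intro small_not_dvd) auto
    then have "b (x + d) \<noteq> h (a x)"
      using b_eq[of "x + d" x] by (simp add: b_def)
    then show "e \<in> complete_bipartite_edges A B - M"
      using a_in b_in h_iff unfolding e complete_bipartite_edges_def by blast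
  next
    fix e assume e: "e \<in> complete_bipartite_edges A B - M"
    then obtain x y where xy: "e = {a x, b y}"
      unfolding complete_bipartite_edges_def range_a[symmetric] range_b[symmetric] by blast
    define d where "d = (y - x) mod int n"
    have "b y \<noteq> b x"
      using e h_iff[OF a_in b_in] unfolding xy by (simp add: b_def)
    then have "d \<noteq> 0"
      using b_eq by (auto simp: d_def)
    moreover have "0 \<le> d" "d < int n"
      using n_pos by (simp_all add: d_def)
    ultimately have "d \<in> {1..2 * int r}" by (simp add: n_def)
    moreover have "int n dvd y - (x + d)"
      unfolding d_def using dvd_minus_mod[of "int n" "y - x"] by (simp add: algebra_simps)
    then have "b y = b (x + d)" by (simp add: b_eq)
    ultimately show "e \<in> E" unfolding xy E_def by auto
  qed
  moreover have "a 0 = u" using k by (simp add: a_def)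
  ultimately show ?thesis
    using avoiding range_a range_b by (simp add: V_def)
qed

theorem theorem6:
  fixes r :: nat and A B :: "'a set" and M :: "'a set set"
  assumes "r \<ge> 2"
    and "finite A" and "finite B" and "A \<inter> B = {}"
    and "card A = 2 * r + 1" and "card B = 2 * r + 1"
    and "perfect_matching (A \<union> B) (complete_bipartite_edges A B) M"
  shows "doubly_eulerian (A \<union> B) (complete_bipartite_edges A B - M)"
proof -
  have swap: "complete_bipartite_edges B A = complete_bipartite_edges A B"
    unfolding complete_bipartite_edges_def by (auto simp: insert_commute)
  have *: "\<exists>p q. avoiding_circuits (A \<union> B) (complete_bipartite_edges A B - M) u p q"
    if "u \<in> A \<union> B" for u
  proof (cases "u \<in> A")
    case True
    then show ?thesis using avoiding_circuits_left[OF assms(1,4,5,7)] by simp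
  next
    \<comment> \<open>For \<open>u\<close> in \<open>B\<close> the two sides exchange roles; the
      graph and the matching stay the same.\<close>
    case False
    then have "u \<in> B" using that by simp
    then have "\<exists>p q. avoiding_circuits (B \<union> A) (complete_bipartite_edges B A - M) u p q"
    proof (intro avoiding_circuits_left)
      show "B \<inter> A = {}" using assms(4) by blast
      show "perfect_matching (B \<union> A) (complete_bipartite_edges B A) M"
        using assms(7) by (simp only: swap Un_commute[of B A])
    qed (rule assms)+
    then show ?thesis by (simp only: swap Un_commute[of B A])
  qed
  moreover obtain u where "u \<in> A" using assms(5) by fastforce
  then have "eulerian (A \<union> B) (complete_bipartite_edges A B - M)"
    using *[of u] unfolding eulerian_def avoiding_circuits_def by blast
  ultimately show ?thesis
    unfolding doubly_eulerian_def by blast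
qed

end
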